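(* For the makespan recovery problem with a single perturbation and a LexOpt initial schedule, the recovery strategy achieves a tight price of robustness equal to $2$. That is: (i) for every instance $I_{init}$ of $P||C_{\max}$, every LexOpt schedule $S_{init}$ for $I_{init}$, every instance $I_{new}$ obtained from $I_{init}$ by a single perturbation, and every schedule $S_{rec}$ for $I_{new}$ produced from $S_{init}$ by the recovery strategy, $$C_{\max}(S_{rec})\le 2\cdot C_{\max}(S_{new}),$$ where $S_{new}$ is a minimum makespan schedule for $I_{new}$; and (ii) the constant $2$ in this statement cannot be replaced by any smaller constant.
   Context: $P||C_{\max}$: an instance $(m,\mathcal{J})$ consists of a set $\mathcal{M}$ of $m\ge 1$ parallel identical machines and a finite set $\mathcal{J}$ of jobs with processing times $p_j>0$. A schedule $S$ assigns each job to exactly one machine; the completion time $C_i(S)$ of machine $M_i$ is the sum of the processing times of its jobs, and the makespan is $C_{\max}(S)=\max_i C_i(S)$. LexOpt schedule: a schedule whose vector of machine completion times, sorted in non-increasing order, is lexicographically minimum among all schedules of the instance. Single perturbation: $I_{new}$, with machine set $\hat{\mathcal{M}}\neq\emptyset$ and job set $\hat{\mathcal{J}}$ with processing times $\hat p_j$, is obtained from $I_{init}$ by exactly one of: (1) the processing time of one job $J_j\in\mathcal{J}$ is reduced to $\hat p_j=p_j/f_j$ with $f_j>1$; (2) the processing time of one job $J_j\in\mathcal{J}$ is augmented to $\hat p_j=f_jp_j$ with $f_j>1$; (3) one job of $\mathcal{J}$ is cancelled (removed); (4) one new job arrives; (5) one machine of $\mathcal{M}$ fails (is removed); (6) one new machine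 is activated (added). Everything else is unchanged. Recovery strategy: (1) every job $J_j\in\mathcal{J}\cap\hat{\mathcal{J}}$ that $S_{init}$ assigns to a machine in $\mathcal{M}\cap\hat{\mathcal{M}}$ stays on that machine (with its new processing time $\hat p_j$); (2) all other jobs of $\hat{\mathcal{J}}$ (new jobs and jobs whose machine failed) are then assigned one by one in non-increasing order of processing time, each to a currently least loaded machine of $\hat{\mathcal{M}}$ (Longest Processing Time first; ties broken arbitrarily). Price of robustness: the worst-case ratio $C_{\max}(S_{rec})/C_{\max}(S_{new})$. *)

theory Defs
  imports "HOL-Library.Multiset" "HOL-Library.Extended_Real"
begin

record ('m, 'j) problem =
  machines :: "'m set"
  jobs :: "'j set"
  ptime :: "'j \<Rightarrow> real"  \<comment> \<open>values outside \<open>jobs\<close> are irrelevant\<close>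

definition valid_problem :: "('m, 'j) problem \<Rightarrow> bool" where
  "valid_problem I \<longleftrightarrow>
     finite (machines I) \<and> machines I \<noteq> {} \<and> finite (jobs I) \<and> (\<forall>j\<in>jobs I. ptime I j > 0)"

text \<open>A map from jobs to machines is a partial schedule; it is a schedule when its domain is the
  whole job set.\<close>

definition schedule :: "('m, 'j) problem \<Rightarrow> ('j \<rightharpoonup> 'm) \<Rightarrow> bool" where
  "schedule I S \<longleftrightarrow> dom S = jobs I \<and> ran S \<subseteq> machines I"

definition load :: "('m, 'j) problem \<Rightarrow> ('j \<rightharpoonup> 'm) \<Rightarrow> 'm \<Rightarrow> real" where
  "load I S i = (\<Sum>j | S j = Some i. ptime I j)"

definition makespan :: "('m, 'j) problem \<Rightarrow> ('j \<rightharpoonup> 'm) \<Rightarrow> real" where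
  "makespan I S = Max (load I S ` machines I)"

definition min_makespan :: "('m, 'j) problem \<Rightarrow> ('j \<rightharpoonup> 'm) \<Rightarrow> bool" where
  "min_makespan I S \<longleftrightarrow> is_arg_min (makespan I) (schedule I) S"

definition sorted_completion_times :: "('m, 'j) problem \<Rightarrow> ('j \<rightharpoonup> 'm) \<Rightarrow> real list" where
  "sorted_completion_times I S =
     rev (sorted_list_of_multiset (image_mset (load I S) (mset_set (machines I))))"

definition lexopt :: "('m, 'j) problem \<Rightarrow> ('j \<rightharpoonup> 'm) \<Rightarrow> bool" where
  "lexopt I S \<longleftrightarrow> schedule I S \<and>
     (\<forall>T. schedule I T \<longrightarrow>
        ord_class.lexordp_eq (sorted_completion_times I S) (sorted_completion_times I T))"

definition same_ptimes :: "'j set \<Rightarrow> ('m, 'j) problem \<Rightarrow> ('m, 'j) problem \<Rightarrow> bool" where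
  "same_ptimes A I I' \<longleftrightarrow> (\<forall>j\<in>A. ptime I' j = ptime I j)"

definition job_reduced :: "('m, 'j) problem \<Rightarrow> ('m, 'j) problem \<Rightarrow> bool" where
  "job_reduced I I' \<longleftrightarrow> machines I' = machines I \<and> jobs I' = jobs I \<and>
     (\<exists>j\<in>jobs I. \<exists>f>1. ptime I' j = ptime I j / f \<and> same_ptimes (jobs I - {j}) I I')"

definition job_augmented :: "('m, 'j) problem \<Rightarrow> ('m, 'j) problem \<Rightarrow> bool" where
  "job_augmented I I' \<longleftrightarrow> machines I' = machines I \<and> jobs I' = jobs I \<and>
     (\<exists>j\<in>jobs I. \<exists>f>1. ptime I' j = f * ptime I j \<and> same_ptimes (jobs I - {j}) I I')"

definition job_cancelled :: "('m, 'j) problem \<Rightarrow> ('m, 'j) problem \<Rightarrow> bool" where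
  "job_cancelled I I' \<longleftrightarrow> machines I' = machines I \<and>
     (\<exists>j\<in>jobs I. jobs I' = jobs I - {j} \<and> same_ptimes (jobs I - {j}) I I')"

definition job_arrived :: "('m, 'j) problem \<Rightarrow> ('m, 'j) problem \<Rightarrow> bool" where
  "job_arrived I I' \<longleftrightarrow> machines I' = machines I \<and>
     (\<exists>j. j \<notin> jobs I \<and> jobs I' = insert j (jobs I)) \<and> same_ptimes (jobs I) I I'"

definition machine_failed :: "('m, 'j) problem \<Rightarrow> ('m, 'j) problem \<Rightarrow> bool" where
  "machine_failed I I' \<longleftrightarrow> (\<exists>i\<in>machines I. machines I' = machines I - {i}) \<and>
     jobs I' = jobs I \<and> same_ptimes (jobs I) I I'"

definition machine_activated :: "('m, 'j) problem \<Rightarrow> ('m, 'j) problem \<Rightarrow> bool" where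
  "machine_activated I I' \<longleftrightarrow> (\<exists>i. i \<notin> machines I \<and> machines I' = insert i (machines I)) \<and>
     jobs I' = jobs I \<and> same_ptimes (jobs I) I I'"

text \<open>On valid problems the six cases are mutually exclusive. Validity of \<open>I'\<close> rules out the
  failure of the only machine and gives an arriving job a positive processing time.\<close>

definition single_perturbation :: "('m, 'j) problem \<Rightarrow> ('m, 'j) problem \<Rightarrow> bool" where
  "single_perturbation I I' \<longleftrightarrow> valid_problem I' \<and>
     (job_reduced I I' \<or> job_augmented I I' \<or> job_cancelled I I' \<or> job_arrived I I' \<or>
      machine_failed I I' \<or> machine_activated I I')"

text \<open>\<open>list_schedule I S js S'\<close>: starting from the partial schedule \<open>S\<close>, the jobs of \<open>js\<close> can be
  assigned in this order, each to a currently least loaded machine, so as to reach \<open>S'\<close>.\<close>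

inductive list_schedule ::
  "('m, 'j) problem \<Rightarrow> ('j \<rightharpoonup> 'm) \<Rightarrow> 'j list \<Rightarrow> ('j \<rightharpoonup> 'm) \<Rightarrow> bool" for I where
  Nil: "list_schedule I S [] S"
| Cons: "is_arg_min (load I S) (\<lambda>i. i \<in> machines I) i \<Longrightarrow>
    list_schedule I (S(j \<mapsto> i)) js S' \<Longrightarrow> list_schedule I S (j # js) S'"

definition kept_jobs ::
  "('m, 'j) problem \<Rightarrow> ('m, 'j) problem \<Rightarrow> ('j \<rightharpoonup> 'm) \<Rightarrow> 'j set" where
  "kept_jobs I I' S =
     {j \<in> jobs I \<inter> jobs I'. \<exists>i \<in> machines I \<inter> machines I'. S j = Some i}"

definition recovery ::
  "('m, 'j) problem \<Rightarrow> ('m, 'j) problem \<Rightarrow> ('j \<rightharpoonup> 'm) \<Rightarrow> ('j \<rightharpoonup> 'm) \<Rightarrow> bool" where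
  "recovery I I' S S' \<longleftrightarrow>
     (\<exists>js. distinct js \<and> set js = jobs I' - kept_jobs I I' S \<and>
           sorted_wrt (\<lambda>a b. ptime I' a \<ge> ptime I' b) js \<and>
           list_schedule I' (S |` kept_jobs I I' S) js S')"

definition recovery_scenario ::
  "('m, 'j) problem \<Rightarrow> ('j \<rightharpoonup> 'm) \<Rightarrow> ('m, 'j) problem \<Rightarrow> ('j \<rightharpoonup> 'm) \<Rightarrow> ('j \<rightharpoonup> 'm) \<Rightarrow> bool" where
  "recovery_scenario I_init S_init I_new S_rec S_new \<longleftrightarrow>
     valid_problem I_init \<and> lexopt I_init S_init \<and> single_perturbation I_init I_new \<and>
     recovery I_init I_new S_init S_rec \<and> min_makespan I_new S_new"

text \<open>The supremum is taken in \<open>ereal\<close>, so that it is meaningful without knowing that the ratios are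
  bounded; problems without jobs are left out because their optimal makespan is \<open>0\<close>. Since problems
  are finite, labelling machines and jobs by natural numbers loses no generality.\<close>

definition price_of_robustness :: ereal where
  "price_of_robustness =
     Sup {ereal (makespan I_new S_rec / makespan I_new S_new) |
          (I_init :: (nat, nat) problem) S_init I_new S_rec S_new.
          recovery_scenario I_init S_init I_new S_rec S_new \<and> jobs I_new \<noteq> {}}"

end

theory Submission
  imports Defs
begin

text \<open>A LexOpt schedule has minimum makespan and is locally optimal: the load of a machine is at
  most the load that another machine would get by taking over one of its jobs. After an
  augmentation, an arrival or a failure the optimum does not decrease, so the kept jobs already load
  every machine by at most the new optimum plus one processing time. After a reduction, a
  cancellation or an activation local optimality survives except towards one machine \<open>e\<close>. A
  machine \<open>k\<close> with at least two jobs then has load at most twice that of every other machine but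
  \<open>e\<close>; the surplus of \<open>k\<close> itself compensates for \<open>e\<close>, so the average load is at least half the load
  of \<open>k\<close>. Finally, Graham's argument shows that list scheduling keeps loads below twice the optimum.
  Tightness: two unit jobs on a single machine when a second machine is activated.\<close>

section \<open>Loads of partial schedules\<close>

lemma load_upd:
  assumes "finite (dom P)" "j \<notin> dom P"
  shows "load I (P(j \<mapsto> i)) k = load I P k + (if k = i then ptime I j else 0)"
proof -
  have fin: "finite {j'. P j' = Some k}"
    by (rule finite_subset[OF _ assms(1)]) auto
  have "{j'. (P(j \<mapsto> i)) j' = Some k} =
      (if k = i then insert j {j'. P j' = Some k} else {j'. P j' = Some k})"
    using assms(2) by auto
  then show ?thesis
    using fin assms(2) by (auto simp: load_def domIff)
qed

lemma load_remove:
  assumes "finite (dom P)" "P j = Some k"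
  shows "load I P i = load I (P(j := None)) i + (if i = k then ptime I j else 0)"
proof -
  have "P = (P(j := None))(j \<mapsto> k)"
    using assms(2) by auto
  then show ?thesis
    using load_upd[of "P(j := None)" j I k i] assms(1) by simp
qed

lemma load_nonneg:
  assumes "\<And>j. j \<in> dom P \<Longrightarrow> ptime I j \<ge> 0"
  shows "load I P i \<ge> 0"
  unfolding load_def using assms by (intro sum_nonneg) auto

lemma load_mono:
  assumes "finite (dom Q)" "P \<subseteq>\<^sub>m Q"
    and "\<And>j. j \<in> dom P \<Longrightarrow> ptime I j \<le> ptime I' j"
    and "\<And>j. j \<in> dom Q \<Longrightarrow> ptime I' j \<ge> 0"
  shows "load I P i \<le> load I' Q i"
proof -
  have sub: "{j. P j = Some i} \<subseteq> {j. Q j = Some i}"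
    using assms(2) by (auto simp: map_le_def dom_def)
  have fin: "finite {j. Q j = Some i}"
    by (rule finite_subset[OF _ assms(1)]) auto
  have "load I P i \<le> (\<Sum>j | P j = Some i. ptime I' j)"
    unfolding load_def using assms(3) by (intro sum_mono) auto
  also have "\<dots> \<le> load I' Q i"
    unfolding load_def using sub fin assms(4) by (intro sum_mono2) auto
  finally show ?thesis .
qed

lemma load_cong:
  assumes "\<And>j. P j = Some i \<longleftrightarrow> Q j = Some i" "\<And>j. P j = Some i \<Longrightarrow> ptime I j = ptime I' j"
  shows "load I P i = load I' Q i"
  unfolding load_def using assms by (intro sum.cong) auto

lemma sum_load:
  assumes "finite (dom P)" "finite (machines I)" "ran P \<subseteq> machines I"
  shows "(\<Sum>i\<in>machines I. load I P i) = (\<Sum>j\<in>dom P. ptime I j)"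
proof -
  have "{j \<in> dom P. the (P j) = i} = {j. P j = Some i}" for i
    by auto
  moreover have "(\<lambda>j. the (P j)) ` dom P \<subseteq> machines I"
    using assms(3) by (auto simp: ran_def)
  ultimately show ?thesis
    using sum.group[OF assms(1,2), of "\<lambda>j. the (P j)" "ptime I"] by (simp add: load_def)
qed

lemma ptime_le_load:
  assumes "finite (dom P)" "\<And>j. j \<in> dom P \<Longrightarrow> ptime I j \<ge> 0" "P j = Some i"
  shows "ptime I j \<le> load I P i"
  using load_remove[OF assms(1,3), of I i] load_nonneg[of "P(j := None)" I i] assms(2) by simp

section \<open>Makespan and its lower bounds: largest job and average load\<close>

lemma makespan_le_iff:
  assumes "valid_problem I"
  shows "makespan I S \<le> B \<longleftrightarrow> (\<forall>i\<in>machines I. load I S i \<le> B)"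
  using assms by (simp add: makespan_def valid_problem_def)

lemma load_le_makespan:
  assumes "valid_problem I" "i \<in> machines I"
  shows "load I S i \<le> makespan I S"
  using makespan_le_iff[OF assms(1)] assms(2) by blast

lemma schedule_finite: "valid_problem I \<Longrightarrow> schedule I S \<Longrightarrow> finite (dom S)"
  by (simp add: valid_problem_def schedule_def)

lemma schedule_ptime_pos: "valid_problem I \<Longrightarrow> schedule I S \<Longrightarrow> j \<in> dom S \<Longrightarrow> ptime I j > 0"
  by (simp add: valid_problem_def schedule_def)

lemma makespan_nonneg:
  assumes "valid_problem I" "schedule I S"
  shows "makespan I S \<ge> 0"
proof -
  obtain i where "i \<in> machines I"
    using assms(1) by (auto simp: valid_problem_def)
  moreover have "load I S i \<ge> 0"
    using schedule_ptime_pos[OF assms] by (intro load_nonneg) (simp add: less_imp_le)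
  ultimately show ?thesis
    using load_le_makespan[OF assms(1)] order_trans by blast
qed

lemma ptime_le_makespan:
  assumes "valid_problem I" "schedule I S" "j \<in> jobs I"
  shows "ptime I j \<le> makespan I S"
proof -
  obtain i where i: "S j = Some i" "i \<in> machines I"
    using assms(2,3) by (auto simp: schedule_def ran_def dom_def)
  have "ptime I j \<le> load I S i"
    using schedule_finite[OF assms(1,2)] schedule_ptime_pos[OF assms(1,2)] i(1)
    by (intro ptime_le_load) (simp_all add: less_imp_le)
  also have "\<dots> \<le> makespan I S"
    using assms(1) i(2) by (rule load_le_makespan)
  finally show ?thesis .
qed

lemma sum_ptime_le_makespan:
  assumes "valid_problem I" "schedule I S"
  shows "(\<Sum>j\<in>jobs I. ptime I j) \<le> card (machines I) * makespan I S"
proof -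
  have "(\<Sum>j\<in>jobs I. ptime I j) = (\<Sum>i\<in>machines I. load I S i)"
    using sum_load[of S I] schedule_finite[OF assms] assms
    by (simp add: schedule_def valid_problem_def)
  also have "\<dots> \<le> card (machines I) * makespan I S"
    using load_le_makespan[OF assms(1)] by (intro sum_bounded_above) simp
  finally show ?thesis .
qed

section \<open>LexOpt schedules: minimum makespan and local optimality\<close>

text \<open>Equal multiplicities above \<open>a\<close> make the two lists agree while their entries
  exceed \<open>a\<close>. Then \<open>xs\<close> runs out of copies of \<open>a\<close> first, and
  at that position it ends or continues with a smaller entry.\<close>

lemma lexordp_sorted_desc:
  fixes xs ys :: "'a::linorder list"
  assumes "sorted_wrt (\<ge>) xs" "sorted_wrt (\<ge>) ys"
    and "\<And>x. x > a \<Longrightarrow> count (mset xs) x = count (mset ys) x"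
    and "count (mset xs) a < count (mset ys) a"
  shows "ord_class.lexordp xs ys"
  using assms
proof (induction xs arbitrary: ys)
  case Nil
  then show ?case by (cases ys) auto
next
  case (Cons x xs)
  have "a \<in># mset ys"
    using Cons.prems(4) by (metis count_greater_zero_iff gr_zeroI not_less_zero)
  then obtain y ys' where ys: "ys = y # ys'"
    by (cases ys) auto
  have ge: "a \<le> y"
    using \<open>a \<in># mset ys\<close> Cons.prems(2) ys by auto
  consider "x < y" | "x = y" | "y < x" by fastforce
  then show ?case
  proof cases
    case 1
    then show ?thesis by (simp add: ys)
  next
    case 2
    have "ord_class.lexordp xs ys'"
    proof (rule Cons.IH)
      show "count (mset xs) z = count (mset ys') z" if "z > a" for z
        using Cons.prems(3)[OF that] by (simp add: ys 2 split: if_splits)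
    qed (use Cons.prems ys 2 in \<open>auto split: if_splits\<close>)
    then show ?thesis by (simp add: ys 2)
  next
    case 3
    \<comment> \<open>This case is impossible: \<open>x\<close> lies above \<open>a\<close>, so it
      also occurs in \<open>ys\<close>, whose largest entry is its head \<open>y\<close>.\<close>
    then have "a < x"
      using ge by simp
    then have "count (mset ys) x > 0"
      using Cons.prems(3)[of x] by (metis count_greater_zero_iff list.set_intros(1) set_mset_mset)
    then have "x \<in> set ys"
      by (metis count_greater_zero_iff set_mset_mset)
    then have "x \<le> y"
      using Cons.prems(2) ys by auto
    then show ?thesis using 3 by simp
  qed
qed

lemma count_image_mset_set:
  "finite A \<Longrightarrow> count (image_mset f (mset_set A)) x = card {a \<in> A. f a = x}"
  by (simp add: count_image_mset' count_mset_set' eq_commute[of x] flip: card_eq_sum)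

text \<open>Later arguments use LexOpt in this form: comparing the sets of machines at each load
  level avoids reasoning about positions in the sorted vectors. As there are finitely many machines,
  a strictly smaller level set at \<open>a\<close> has smaller multiplicity, so the vector of
  \<open>T\<close> would be lexicographically smaller.\<close>

lemma lexopt_not_improvable:
  assumes "valid_problem I" "lexopt I S" "schedule I T"
    and above: "\<And>x. x > a \<Longrightarrow>
      {i \<in> machines I. load I T i = x} = {i \<in> machines I. load I S i = x}"
    and at: "{i \<in> machines I. load I T i = a} \<subset> {i \<in> machines I. load I S i = a}"
  shows False
proof -
  have fin: "finite (machines I)"
    using assms(1) by (simp add: valid_problem_def)
  have count: "count (mset (sorted_completion_times I S')) x =
      card {i \<in> machines I. load I S' i = x}" for S' x
    by (simp add: sorted_completion_times_def count_image_mset_set[OF fin])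
  have sorted: "sorted_wrt (\<ge>) (sorted_completion_times I S')" for S'
    by (simp add: sorted_completion_times_def sorted_wrt_rev)
  have "card {i \<in> machines I. load I T i = a} < card {i \<in> machines I. load I S i = a}"
    using fin by (intro psubset_card_mono at) simp
  then have "ord_class.lexordp (sorted_completion_times I T) (sorted_completion_times I S)"
    by (intro lexordp_sorted_desc[of _ _ a] sorted) (simp_all add: count above)
  moreover have "ord_class.lexordp_eq (sorted_completion_times I S) (sorted_completion_times I T)"
    using assms(2,3) by (simp add: lexopt_def)
  ultimately show False
    by (meson lexordp_conv_lexordp_eq)
qed

lemma lexopt_makespan_le:
  assumes "valid_problem I" "lexopt I S" "schedule I T"
  shows "makespan I S \<le> makespan I T"
proof (rule ccontr)
  assume "\<not> makespan I S \<le> makespan I T"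
  then have T: "load I T i < makespan I S" if "i \<in> machines I" for i
    using load_le_makespan[OF assms(1) that, of T] by simp
  have S: "load I S i \<le> makespan I S" if "i \<in> machines I" for i
    using load_le_makespan[OF assms(1) that] .
  \<comment> \<open>The critical level is the makespan of \<open>S\<close>: some machine attains it
    under \<open>S\<close>, none reaches it under \<open>T\<close>.\<close>
  have "makespan I S \<in> load I S ` machines I"
    using assms(1) unfolding makespan_def valid_problem_def by (intro Max_in) auto
  then have "{i \<in> machines I. load I T i = makespan I S} \<subset>
      {i \<in> machines I. load I S i = makespan I S}"
    using T by force
  moreover have "{i \<in> machines I. load I T i = x} = {i \<in> machines I. load I S i = x}"
    if "x > makespan I S" for x
    using that S T by fastforce
  ultimately show False
    using lexopt_not_improvable[OF assms] by blast
qed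

text \<open>Otherwise move \<open>j\<close> from \<open>k\<close> to \<open>h\<close>. Both machines
  then lie strictly below the old load of \<open>k\<close> and no other load changes, so the level
  set at that load loses \<open>k\<close> and gains nothing, while the higher levels stay the
  same.\<close>

lemma lexopt_local_optimal:
  assumes "valid_problem I" "lexopt I S" "S j = Some k" "h \<in> machines I" "h \<noteq> k"
  shows "load I S k \<le> load I S h + ptime I j"
proof (rule ccontr)
  assume less: "\<not> load I S k \<le> load I S h + ptime I j"
  have sched: "schedule I S"
    using assms(2) by (simp add: lexopt_def)
  have fin: "finite (dom S)"
    using schedule_finite[OF assms(1) sched] .
  have pos: "ptime I j > 0"
    using schedule_ptime_pos[OF assms(1) sched] assms(3) by auto
  have k: "k \<in> machines I"
    using sched assms(3) by (auto simp: schedule_def ran_def)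
  have sched': "schedule I (S(j \<mapsto> h))"
    using sched assms(3,4) by (auto simp: schedule_def ran_def)
  have load: "load I (S(j \<mapsto> h)) i =
      load I S i + (if i = h then ptime I j else 0) - (if i = k then ptime I j else 0)" for i
    using load_remove[OF fin assms(3), of I i] load_upd[of "S(j := None)" j I h i] fin by simp
  have "{i \<in> machines I. load I (S(j \<mapsto> h)) i = x} = {i \<in> machines I. load I S i = x}"
    if "x > load I S k" for x
    using that less pos assms(5) unfolding load by (auto split: if_splits)
  moreover have "{i \<in> machines I. load I (S(j \<mapsto> h)) i = load I S k} \<subset>
      {i \<in> machines I. load I S i = load I S k}"
  proof -
    have "k \<notin> {i \<in> machines I. load I (S(j \<mapsto> h)) i = load I S k}"
      using pos assms(5) by (simp add: load)
    moreover have "{i \<in> machines I. load I (S(j \<mapsto> h)) i = load I S k} \<subseteq>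
        {i \<in> machines I. load I S i = load I S k}"
      using less pos assms(5) by (auto simp: load split: if_splits)
    ultimately show ?thesis
      using k by blast
  qed
  ultimately show False
    using lexopt_not_improvable[OF assms(1,2) sched'] by blast
qed

section \<open>List scheduling from a partial schedule\<close>

text \<open>The bound is an invariant of list scheduling. Only the machine receiving the next job
  changes; its previous load is at most the average load and the job is a single job, and each of
  the two is at most \<open>makespan I T\<close>.\<close>

lemma list_schedule_load_le:
  assumes "list_schedule I P js P'"
    and "valid_problem I" "schedule I T"
    and "distinct js" "dom P \<inter> set js = {}" "dom P \<union> set js \<subseteq> jobs I" "ran P \<subseteq> machines I"
    and "\<And>i. i \<in> machines I \<Longrightarrow> load I P i \<le> 2 * makespan I T"
    and "i \<in> machines I"
  shows "load I P' i \<le> 2 * makespan I T"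
  using assms
proof (induction arbitrary: i)
  case (Nil P)
  then show ?case by simp
next
  case (Cons P k j js P')
  note valid = Cons.prems(1)
  have fin: "finite (jobs I)" "finite (machines I)" and pos: "\<And>l. l \<in> jobs I \<Longrightarrow> ptime I l > 0"
    and ne: "machines I \<noteq> {}"
    using valid by (auto simp: valid_problem_def)
  have finP: "finite (dom P)"
    using Cons.prems(5) fin(1) by (auto intro: finite_subset)
  have k: "k \<in> machines I" and least: "\<And>h. h \<in> machines I \<Longrightarrow> load I P k \<le> load I P h"
    using Cons.hyps(1) by (auto simp: is_arg_min_linorder)
  \<comment> \<open>The least load is at most the average, and the total load of a partial schedule
    is at most the total processing time.\<close>
  have "card (machines I) * load I P k \<le> (\<Sum>h\<in>machines I. load I P h)"
    using least by (intro sum_bounded_below) simp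
  also have "\<dots> = (\<Sum>l\<in>dom P. ptime I l)"
    using finP fin(2) Cons.prems(6) by (rule sum_load)
  also have "\<dots> \<le> (\<Sum>l\<in>jobs I. ptime I l)"
    using fin(1) pos Cons.prems(5) by (intro sum_mono2) (auto simp: less_imp_le)
  also have "\<dots> \<le> card (machines I) * makespan I T"
    using Cons.prems(1,2) by (rule sum_ptime_le_makespan)
  finally have "load I P k \<le> makespan I T"
    using fin(2) ne by (simp add: card_gt_0_iff)
  moreover have "ptime I j \<le> makespan I T"
    using Cons.prems(1,2,5) by (intro ptime_le_makespan) auto
  ultimately have bound: "load I (P(j \<mapsto> k)) h \<le> 2 * makespan I T" if "h \<in> machines I" for h
    using Cons.prems(7)[OF that] Cons.prems(4) load_upd[OF finP, of j I k h] by auto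
  show ?case
  proof (rule Cons.IH[OF valid Cons.prems(2)])
    show "ran (P(j \<mapsto> k)) \<subseteq> machines I"
      using Cons.prems(6) k by (auto simp: ran_def)
    show "dom (P(j \<mapsto> k)) \<inter> set js = {}"
      using Cons.prems(3,4) by auto
    show "dom (P(j \<mapsto> k)) \<union> set js \<subseteq> jobs I"
      using Cons.prems(5) by auto
    show "load I (P(j \<mapsto> k)) h \<le> 2 * makespan I T" if "h \<in> machines I" for h
      using that by (rule bound)
  qed (use Cons.prems in auto)
qed

section \<open>Local optimality up to one exceptional machine\<close>

text \<open>The exceptional machine \<open>e\<close> stands for the one that lost work or was just
  activated. It may coincide with \<open>k\<close> or lie outside \<open>machines I\<close>. With at
  most one job on \<open>k\<close> the largest-job bound suffices; with two jobs the averaging bound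
  applies.\<close>

lemma locally_optimal_load_le:
  assumes "valid_problem I" "schedule I T" "dom P \<subseteq> jobs I" "ran P \<subseteq> machines I"
    and k: "k \<in> machines I"
    and opt: "\<And>j h. P j = Some k \<Longrightarrow> h \<in> machines I \<Longrightarrow> h \<noteq> k \<Longrightarrow> h \<noteq> e \<Longrightarrow>
      load I P k \<le> load I P h + ptime I j"
  shows "load I P k \<le> 2 * makespan I T"
proof -
  have fin: "finite (jobs I)" "finite (machines I)" and pos: "\<And>l. l \<in> jobs I \<Longrightarrow> ptime I l > 0"
    using assms(1) by (auto simp: valid_problem_def)
  have finP: "finite (dom P)"
    using assms(3) fin(1) by (rule finite_subset)
  have nonneg: "load I P h \<ge> 0" for h
    using assms(3) pos by (intro load_nonneg) (auto simp: less_imp_le)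
  have T: "makespan I T \<ge> 0"
    using assms(1,2) by (rule makespan_nonneg)
  consider "\<And>j. P j \<noteq> Some k"
    | j where "P j = Some k" "\<And>j'. P j' = Some k \<Longrightarrow> j' = j"
    | j j' where "P j = Some k" "P j' = Some k" "j \<noteq> j'"
    by metis
  then show ?thesis
  proof cases
    case 1
    then show ?thesis using T by (simp add: load_def)
  next
    case 2
    then have "{j'. P j' = Some k} = {j}" by blast
    then have "load I P k = ptime I j" by (simp add: load_def)
    also have "\<dots> \<le> makespan I T"
      using 2(1) assms(1-3) by (intro ptime_le_makespan) auto
    finally show ?thesis using T by simp
  next
    case 3
    have "ptime I j' \<le> load I (P(j := None)) k"
      using finP 3 pos assms(3) by (intro ptime_le_load) (auto simp: less_imp_le)
    then have two: "ptime I j + ptime I j' \<le> load I P k"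
      using load_remove[OF finP 3(1), of I k] by simp
    \<comment> \<open>Adding local optimality for \<open>j\<close> and \<open>j'\<close> gives twice
      the load of \<open>h\<close> at least \<open>2 * load I P k\<close> minus both processing
      times, which together are at most \<open>load I P k\<close>.\<close>
    have half: "load I P k / 2 \<le> load I P h" if "h \<in> machines I" "h \<noteq> k" "h \<noteq> e" for h
      using two opt[OF 3(1) that] opt[OF 3(2) that] by argo
    \<comment> \<open>Relative to the target average \<open>load I P k / 2\<close>, only
      \<open>e\<close> can have a deficit, and by nonnegativity of loads it is at most
      \<open>load I P k / 2\<close>.\<close>
    have "- load I P k / 2 \<le> (\<Sum>h\<in>machines I - {k}. if h = e then - load I P k / 2 else 0)"
      using fin(2) nonneg[of k] by (simp add: sum.delta)
    also have "\<dots> \<le> (\<Sum>h\<in>machines I - {k}. load I P h - load I P k / 2)"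
      using half nonneg by (intro sum_mono) auto
    \<comment> \<open>The term of \<open>k\<close> itself is a surplus of
      \<open>load I P k / 2\<close>, which covers the deficit of \<open>e\<close>.\<close>
    finally have "(\<Sum>h\<in>machines I. load I P h - load I P k / 2) \<ge> 0"
      using fin(2) k by (simp add: sum.remove[of _ k])
    then have "card (machines I) * (load I P k / 2) \<le> (\<Sum>h\<in>machines I. load I P h)"
      by (simp add: sum_subtractf)
    also have "\<dots> = (\<Sum>l\<in>dom P. ptime I l)"
      using finP fin(2) assms(4) by (rule sum_load)
    also have "\<dots> \<le> (\<Sum>l\<in>jobs I. ptime I l)"
      using fin(1) pos assms(3) by (intro sum_mono2) (auto simp: less_imp_le)
    also have "\<dots> \<le> card (machines I) * makespan I T"
      using assms(1,2) by (rule sum_ptime_le_makespan)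
    finally have "load I P k / 2 \<le> makespan I T"
      using fin(2) k by (subst (asm) mult_le_cancel_left_pos) (auto simp: card_gt_0_iff)
    then show ?thesis by simp
  qed
qed

text \<open>Local optimality of \<open>S\<close> says that \<open>k\<close> without \<open>j\<close>
  is loaded no more than \<open>h\<close>. Dropping or shrinking jobs on \<open>k\<close> preserves
  this, and \<open>h\<close> keeps its load unless it is \<open>e\<close>.\<close>

lemma lexopt_decrease_load_le:
  assumes "valid_problem I" "lexopt I S" "valid_problem I'" "schedule I' T"
    and "P \<subseteq>\<^sub>m S" "dom P \<subseteq> jobs I'" "ran P \<subseteq> machines I'"
    and le: "\<And>j. j \<in> dom P \<Longrightarrow> ptime I' j \<le> ptime I j"
    and same: "\<And>h. h \<in> machines I' \<Longrightarrow> h \<noteq> e \<Longrightarrow> h \<in> machines I \<and> load I' P h = load I S h"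
    and k: "k \<in> machines I'"
  shows "load I' P k \<le> 2 * makespan I' T"
proof (rule locally_optimal_load_le[OF assms(3,4,6,7) k, where e = e])
  fix j h
  assume j: "P j = Some k" and h: "h \<in> machines I'" "h \<noteq> k" "h \<noteq> e"
  have sched: "schedule I S"
    using assms(2) by (simp add: lexopt_def)
  have finS: "finite (dom S)"
    using schedule_finite[OF assms(1) sched] .
  have finP: "finite (dom P)"
    using map_le_implies_dom_le[OF assms(5)] finS by (rule finite_subset)
  have Sj: "S j = Some k"
    using assms(5) j by (auto simp: map_le_def dom_def)
  \<comment> \<open>The comparison is made without \<open>j\<close> because \<open>j\<close> may be
    the reduced job: the final inequality needs the new time \<open>ptime I' j\<close>, not the
    larger old one.\<close>
  have "load I' (P(j := None)) k \<le> load I (S(j := None)) k"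
  proof (rule load_mono)
    show "P(j := None) \<subseteq>\<^sub>m S(j := None)"
      using assms(5) by (auto simp: map_le_def)
    show "ptime I l \<ge> 0" if "l \<in> dom (S(j := None))" for l
      using schedule_ptime_pos[OF assms(1) sched, of l] that by (auto simp: less_imp_le)
  qed (use finS le in auto)
  then have "load I' P k \<le> load I S k - ptime I j + ptime I' j"
    using load_remove[OF finP j, of I' k] load_remove[OF finS Sj, of I k] by simp
  also have "\<dots> \<le> load I S h + ptime I' j"
    using lexopt_local_optimal[OF assms(1,2) Sj, of h] same[OF h(1,3)] h(2) by simp
  also have "\<dots> = load I' P h + ptime I' j"
    using same[OF h(1,3)] by simp
  finally show "load I' P k \<le> load I' P h + ptime I' j" .
qed

section \<open>Kept jobs after each kind of perturbation\<close>

text \<open>Restricting a schedule of the harder problem to the old jobs gives a schedule of the old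
  problem with no larger makespan, and \<open>S\<close> is optimal there.\<close>

lemma lexopt_makespan_le_harder:
  assumes "valid_problem I" "lexopt I S" "valid_problem I'" "schedule I' T"
    and "jobs I \<subseteq> jobs I'" "machines I' \<subseteq> machines I"
    and "\<And>j. j \<in> jobs I \<Longrightarrow> ptime I j \<le> ptime I' j"
  shows "makespan I S \<le> makespan I' T"
proof -
  have sched: "schedule I (T |` jobs I)"
  proof -
    have "ran (T |` jobs I) \<subseteq> ran T"
      by (auto simp: ran_def restrict_map_def split: if_splits)
    then show ?thesis
      using assms(4-6) by (auto simp: schedule_def)
  qed
  have "load I (T |` jobs I) i \<le> makespan I' T" for i
  proof (cases "i \<in> machines I'")
    case True
    have "load I (T |` jobs I) i \<le> load I' T i"
      using schedule_finite[OF assms(3,4)] schedule_ptime_pos[OF assms(3,4)] assms(7)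
      by (intro load_mono) (auto simp: map_le_def less_imp_le)
    then show ?thesis
      using load_le_makespan[OF assms(3) True, of T] by simp
  next
    \<comment> \<open>A failed machine receives no job from \<open>T\<close>, so its load is an
      empty sum.\<close>
    case False
    then have "{j. (T |` jobs I) j = Some i} = {}"
      using assms(4) by (auto simp: schedule_def ran_def restrict_map_def split: if_splits)
    then show ?thesis
      using makespan_nonneg[OF assms(3,4)] by (simp add: load_def)
  qed
  then have "makespan I (T |` jobs I) \<le> makespan I' T"
    using makespan_le_iff[OF assms(1)] by blast
  then show ?thesis
    using lexopt_makespan_le[OF assms(1,2) sched] by simp
qed

text \<open>Provides the starting loads for list scheduling. Reduction, cancellation and activation
  are treated by \<open>decrease\<close>, arrival and failure by \<open>unchanged\<close>, and
  augmentation by the old optimum plus one job.\<close>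

lemma kept_load_le:
  assumes "valid_problem I" "lexopt I S" "single_perturbation I I'" "schedule I' T"
    and k: "k \<in> machines I'"
  shows "load I' (S |` kept_jobs I I' S) k \<le> 2 * makespan I' T"
proof -
  let ?P = "S |` kept_jobs I I' S"
  have valid': "valid_problem I'"
    using assms(3) by (simp add: single_perturbation_def)
  have sched: "schedule I S"
    using assms(2) by (simp add: lexopt_def)
  have dom: "dom S = jobs I" and ran: "\<And>j i. S j = Some i \<Longrightarrow> i \<in> machines I"
    using sched by (auto simp: schedule_def ran_def)
  have S_job: "\<And>j i. S j = Some i \<Longrightarrow> j \<in> jobs I"
    using dom by auto
  have finS: "finite (dom S)"
    using schedule_finite[OF assms(1) sched] .
  have posS: "\<And>j. j \<in> dom S \<Longrightarrow> ptime I j \<ge> 0"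
    using schedule_ptime_pos[OF assms(1) sched] by (simp add: less_imp_le)
  have P_Some: "?P j = Some i \<longleftrightarrow> S j = Some i \<and> j \<in> jobs I' \<and> i \<in> machines I'" for j i
    using ran S_job by (auto simp: restrict_map_def kept_jobs_def)
  have P_sub: "?P \<subseteq>\<^sub>m S"
    by (auto simp: map_le_def)
  have P_dom: "dom ?P \<subseteq> jobs I'" and P_ran: "ran ?P \<subseteq> machines I'"
    unfolding dom_def ran_def using P_Some by auto
  have P_dom': "dom ?P \<subseteq> dom S"
    by auto
  \<comment> \<open>Here \<open>e\<close> is chosen in each case so that every job on any other
    machine survives with its old processing time.\<close>
  have decrease: ?thesis
    if "\<And>j. j \<in> jobs I \<Longrightarrow> j \<in> jobs I' \<Longrightarrow> ptime I' j \<le> ptime I j"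
      "\<And>h. h \<in> machines I' \<Longrightarrow> h \<noteq> e \<Longrightarrow> h \<in> machines I"
      "\<And>h j. h \<noteq> e \<Longrightarrow> S j = Some h \<Longrightarrow> j \<in> jobs I' \<and> ptime I' j = ptime I j" for e
  proof (rule lexopt_decrease_load_le[OF assms(1,2) valid' assms(4) P_sub P_dom P_ran _ _ k])
    show "ptime I' j \<le> ptime I j" if "j \<in> dom ?P" for j
      using that P_dom P_dom' dom \<open>\<And>j. j \<in> jobs I \<Longrightarrow> j \<in> jobs I' \<Longrightarrow> ptime I' j \<le> ptime I j\<close>
      by blast
    show "h \<in> machines I \<and> load I' ?P h = load I S h" if "h \<in> machines I'" "h \<noteq> e" for h
    proof
      show "load I' ?P h = load I S h"
        using that \<open>\<And>h j. h \<noteq> e \<Longrightarrow> S j = Some h \<Longrightarrow> j \<in> jobs I' \<and> ptime I' j = ptime I j\<close>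
        by (intro load_cong) (auto simp only: P_Some)
    qed (use that \<open>\<And>h. h \<in> machines I' \<Longrightarrow> h \<noteq> e \<Longrightarrow> h \<in> machines I\<close> in blast)
  qed
  have increase: "load I S k \<le> makespan I' T"
    if "jobs I \<subseteq> jobs I'" "machines I' \<subseteq> machines I"
      "\<And>j. j \<in> jobs I \<Longrightarrow> ptime I j \<le> ptime I' j"
    using lexopt_makespan_le_harder[OF assms(1,2) valid' assms(4) that]
      load_le_makespan[OF assms(1), of k S] k that(2) by fastforce
  \<comment> \<open>The kept jobs are part of \<open>S\<close> with their old times, and the old
    optimum is at most the new one.\<close>
  have unchanged: ?thesis
    if "jobs I \<subseteq> jobs I'" "machines I' \<subseteq> machines I" "same_ptimes (jobs I) I I'"
  proof -
    have "load I' ?P k \<le> load I S k"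
      using finS P_sub posS that(3) P_dom' dom
      by (intro load_mono) (auto simp: same_ptimes_def)
    also have "\<dots> \<le> makespan I' T"
      using that by (intro increase) (auto simp: same_ptimes_def)
    finally show ?thesis
      using makespan_nonneg[OF valid' assms(4)] by simp
  qed
  consider "job_reduced I I'" | "job_augmented I I'" | "job_cancelled I I'" | "job_arrived I I'"
    | "machine_failed I I'" | "machine_activated I I'"
    using assms(3) by (auto simp: single_perturbation_def)
  then show ?thesis
  proof cases
    case 1
    then obtain j f where M: "machines I' = machines I" and J: "jobs I' = jobs I"
      and j: "j \<in> jobs I" "f > 1" "ptime I' j = ptime I j / f"
      and same: "\<And>l. l \<in> jobs I \<Longrightarrow> l \<noteq> j \<Longrightarrow> ptime I' l = ptime I l"
      by (auto simp: job_reduced_def same_ptimes_def)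
    have le: "ptime I' j \<le> ptime I j"
      using j posS[of j] dom frac_le[of "ptime I j" "ptime I j" 1 f] by simp
    show ?thesis
    proof (rule decrease)
      show "ptime I' l \<le> ptime I l" if "l \<in> jobs I" for l
        using le same[OF that] by (cases "l = j") simp_all
      show "h \<in> machines I" if "h \<in> machines I'" for h
        using that M by simp
      \<comment> \<open>The exceptional machine is the one running the reduced job.\<close>
      show "l \<in> jobs I' \<and> ptime I' l = ptime I l" if "h \<noteq> the (S j)" "S l = Some h" for h l
        using that same[of l] S_job[of l] J by force
    qed
  next
    case 2
    then obtain j f where M: "machines I' = machines I" and J: "jobs I' = jobs I"
      and j: "j \<in> jobs I" "f > 1" "ptime I' j = f * ptime I j"
      and same: "\<And>l. l \<in> jobs I \<Longrightarrow> l \<noteq> j \<Longrightarrow> ptime I' l = ptime I l"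
      by (auto simp: job_augmented_def same_ptimes_def)
    have le: "ptime I j \<le> ptime I' j"
      using j posS[of j] dom by (simp add: mult_left_le mult_le_cancel_right1)
    have P: "?P = S"
    proof
      fix l
      show "?P l = S l"
        using ran S_job by (cases "S l") (auto simp: restrict_map_def kept_jobs_def M J)
    qed
    obtain i where i: "S j = Some i"
      using j(1) dom by auto
    \<comment> \<open>The extra term is exact on the machine running \<open>j\<close> and harmless
      elsewhere. The remaining load and the augmented job are each bounded by the new
      optimum.\<close>
    have "load I' S k \<le> load I' (S(j := None)) k + ptime I' j"
      using load_remove[OF finS i, of I' k] le posS[of j] j(1) dom by auto
    also have "load I' (S(j := None)) k \<le> load I S k"
    proof (rule load_mono[OF finS _ _ posS])
      show "S(j := None) \<subseteq>\<^sub>m S"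
        by (simp add: map_le_def)
      show "ptime I' l \<le> ptime I l" if "l \<in> dom (S(j := None))" for l
        using that same[of l] dom by auto
    qed
    also have "load I S k \<le> makespan I' T"
    proof (rule increase)
      show "ptime I l \<le> ptime I' l" if "l \<in> jobs I" for l
        using le same[OF that] by (cases "l = j") simp_all
    qed (use M J in auto)
    also have "ptime I' j \<le> makespan I' T"
      using valid' assms(4) j(1) J by (intro ptime_le_makespan) auto
    finally show ?thesis
      by (simp add: P)
  next
    case 3
    then obtain j where "machines I' = machines I" "j \<in> jobs I" "jobs I' = jobs I - {j}"
      "same_ptimes (jobs I - {j}) I I'"
      by (auto simp: job_cancelled_def)
    \<comment> \<open>The exceptional machine is the one that ran the cancelled job.\<close>
    then show ?thesis
      using S_job by (intro decrease[of "the (S j)"]) (force simp: same_ptimes_def)+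
  next
    case 4
    then show ?thesis
      by (intro unchanged) (auto simp: job_arrived_def)
  next
    case 5
    then show ?thesis
      by (intro unchanged) (auto simp: machine_failed_def)
  next
    case 6
    then obtain i where "machines I' = insert i (machines I)" "jobs I' = jobs I"
      "same_ptimes (jobs I) I I'"
      by (auto simp: machine_activated_def)
    \<comment> \<open>The exceptional machine is the activated one, which holds no kept job.\<close>
    then show ?thesis
      using S_job by (intro decrease[of i]) (auto simp: same_ptimes_def)
  qed
qed

section \<open>The upper bound, its tightness, and the supremum\<close>

lemma recovery_makespan_le:
  assumes "recovery_scenario I S I' S' T"
  shows "makespan I' S' \<le> 2 * makespan I' T"
proof -
  let ?K = "kept_jobs I I' S"
  have valid: "valid_problem I" "valid_problem I'" and lex: "lexopt I S"
    and pert: "single_perturbation I I'" and T: "schedule I' T"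
    using assms
    by (auto simp: recovery_scenario_def single_perturbation_def min_makespan_def is_arg_min_def)
  obtain js where js: "distinct js" "set js = jobs I' - ?K" "list_schedule I' (S |` ?K) js S'"
    using assms by (auto simp: recovery_scenario_def recovery_def)
  have dom: "dom (S |` ?K) \<subseteq> ?K"
    by auto
  have K: "?K \<subseteq> jobs I'"
    by (auto simp: kept_jobs_def)
  have ran: "ran (S |` ?K) \<subseteq> machines I'"
    by (auto simp: ran_def restrict_map_def kept_jobs_def split: if_splits)
  have "load I' S' i \<le> 2 * makespan I' T" if "i \<in> machines I'" for i
    using js(3) valid(2) T js(1) _ _ ran _ that
  proof (rule list_schedule_load_le)
    show "load I' (S |` ?K) h \<le> 2 * makespan I' T" if "h \<in> machines I'" for h
      using valid(1) lex pert T that by (rule kept_load_le)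
  qed (use js(2) dom K in auto)
  then show ?thesis
    using makespan_le_iff[OF valid(2)] by blast
qed

lemma recovery_ratio_attained:
  obtains I I' :: "(nat, nat) problem" and S S' T
  where "recovery_scenario I S I' S' T" "jobs I' \<noteq> {}" "makespan I' S' = 2" "makespan I' T = 1"
proof -
  define I :: "(nat, nat) problem" where
    "I = \<lparr>machines = {0}, jobs = {0, 1}, ptime = \<lambda>_. 1\<rparr>"
  define I' :: "(nat, nat) problem" where
    "I' = \<lparr>machines = {0, 1}, jobs = {0, 1}, ptime = \<lambda>_. 1\<rparr>"
  define S :: "nat \<rightharpoonup> nat" where "S = [0 \<mapsto> 0, 1 \<mapsto> 0]"
  define T :: "nat \<rightharpoonup> nat" where "T = [0 \<mapsto> 0, 1 \<mapsto> 1]"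
  have valid: "valid_problem I" "valid_problem I'"
    by (auto simp: valid_problem_def I_def I'_def)
  \<comment> \<open>A single machine admits only one schedule, so \<open>S\<close> is trivially
    LexOpt.\<close>
  have unique: "U = S" if "schedule I U" for U
  proof
    fix j
    have U: "dom U = {0, 1}" "ran U \<subseteq> {0}"
      using that by (simp_all add: schedule_def I_def)
    show "U j = S j"
    proof (cases "U j")
      case None
      then have "j \<notin> {0, 1}"
        using U(1) by blast
      then show ?thesis using None by (simp add: S_def)
    next
      case (Some i)
      then have "j \<in> {0, 1}" "i = 0"
        using U by (auto simp: ran_def)
      then show ?thesis using Some by (auto simp: S_def)
    qed
  qed
  have "schedule I S"
    by (auto simp: schedule_def I_def S_def ran_def split: if_splits)
  then have lex: "lexopt I S"
    unfolding lexopt_def by (metis unique lexordp_eq_refl)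
  have pert: "single_perturbation I I'"
    unfolding single_perturbation_def machine_activated_def using valid(2)
    by (auto simp: I_def I'_def same_ptimes_def)
  have kept: "kept_jobs I I' S = {0, 1}"
    by (auto simp: kept_jobs_def I_def I'_def S_def)
  have "S |` {0, 1} = S"
    by (auto simp: S_def restrict_map_def)
  \<comment> \<open>All jobs are kept, so the list to be assigned is empty and the new machine stays
    idle.\<close>
  then have "recovery I I' S S"
    unfolding recovery_def kept
    by (intro exI[of _ "[]"]) (auto simp: I'_def intro: list_schedule.Nil)
  moreover have load: "load I' S 0 = 2" "load I' S 1 = 0" "load I' T 0 = 1" "load I' T 1 = 1"
  proof -
    have "{j. S j = Some 0} = {0, 1}" "{j. S j = Some 1} = {}"
      "{j. T j = Some 0} = {0}" "{j. T j = Some 1} = {1}"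
      by (auto simp: S_def T_def split: if_splits)
    then show "load I' S 0 = 2" "load I' S 1 = 0" "load I' T 0 = 1" "load I' T 1 = 1"
      by (simp_all add: load_def I'_def)
  qed
  then have ms: "makespan I' S = 2" "makespan I' T = 1"
    by (simp_all add: makespan_def I'_def)
  have "schedule I' T"
    by (auto simp: schedule_def I'_def T_def ran_def split: if_splits)
  moreover have "makespan I' U \<ge> 1" if "schedule I' U" for U
    using ptime_le_makespan[OF valid(2) that, of 0] by (simp add: I'_def)
  ultimately have "recovery_scenario I S I' S T"
    unfolding recovery_scenario_def min_makespan_def is_arg_min_linorder
    using valid(1) lex pert ms(2) by simp
  moreover have "jobs I' \<noteq> {}"
    by (simp add: I'_def)
  ultimately show ?thesis
    using ms that by blast
qed

theorem theorem4:
  shows "(\<forall>(I_init :: ('m, 'j) problem) S_init I_new S_rec S_new.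
            recovery_scenario I_init S_init I_new S_rec S_new \<longrightarrow>
            makespan I_new S_rec \<le> 2 * makespan I_new S_new) \<and>
         (\<forall>c::real. c < 2 \<longrightarrow>
            \<not> (\<forall>(I_init :: (nat, nat) problem) S_init I_new S_rec S_new.
                  recovery_scenario I_init S_init I_new S_rec S_new \<longrightarrow>
                  makespan I_new S_rec \<le> c * makespan I_new S_new)) \<and>
         price_of_robustness = 2"
proof -
  obtain I I' :: "(nat, nat) problem" and S S' T
    where ex: "recovery_scenario I S I' S' T" "jobs I' \<noteq> {}" "makespan I' S' = 2" "makespan I' T = 1"
    by (rule recovery_ratio_attained)
  have "price_of_robustness = 2"
  proof (rule antisym)
    show "price_of_robustness \<le> 2"
      unfolding price_of_robustness_def
    proof (rule Sup_least, clarify)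
      fix I I' :: "(nat, nat) problem" and S S' T
      assume sc: "recovery_scenario I S I' S' T"
      then have "makespan I' T \<ge> 0"
        by (intro makespan_nonneg)
          (auto simp: recovery_scenario_def single_perturbation_def min_makespan_def is_arg_min_def)
      \<comment> \<open>If the optimum is \<open>0\<close>, the quotient is \<open>0\<close> by the
        convention for division by zero.\<close>
      then have "makespan I' S' / makespan I' T \<le> 2"
        using recovery_makespan_le[OF sc] by (cases "makespan I' T = 0") (auto simp: field_simps)
      then show "ereal (makespan I' S' / makespan I' T) \<le> 2"
        by (metis ereal_less_eq(3) numeral_eq_ereal)
    qed
    have "ereal (makespan I' S' / makespan I' T) \<le> price_of_robustness"
      unfolding price_of_robustness_def using ex(1,2) by (intro Sup_upper) blast
    then show "2 \<le> price_of_robustness"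
      by (simp add: ex)
  qed
  moreover have "\<not> (\<forall>(I_init :: (nat, nat) problem) S_init I_new S_rec S_new.
      recovery_scenario I_init S_init I_new S_rec S_new \<longrightarrow>
      makespan I_new S_rec \<le> c * makespan I_new S_new)" if "c < 2" for c
  proof
    assume "\<forall>(I_init :: (nat, nat) problem) S_init I_new S_rec S_new.
      recovery_scenario I_init S_init I_new S_rec S_new \<longrightarrow>
      makespan I_new S_rec \<le> c * makespan I_new S_new"
    then have "makespan I' S' \<le> c * makespan I' T"
      using ex(1) by blast
    then show False
      using ex(3,4) that by simp
  qed
  ultimately show ?thesis
    by (intro conjI allI impI recovery_makespan_le)
qed

end
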